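(* Suppose there is an algorithm which, given any integer linear recurrence sequence $\langle u_n\rangle_{n=0}^\infty$ of order $6$, decides whether $u_n\ge 0$ for all $n\ge 0$ (i.e. the Positivity Problem is decidable for integer LRS of order $6$). Then for every $t\in\mathcal{T}$, the type $L(t)$ is a computable real number.
   Context: An integer linear recurrence sequence (LRS) of order $k$ is a sequence $\langle u_n\rangle_{n=0}^\infty$ of integers for which there are integers $a_1,\ldots,a_k$ with $a_k\ne 0$ such that $u_{n+k}=a_1u_{n+k-1}+\cdots+a_ku_n$ for all $n\ge0$; it is given as input by the $2k$-tuple $(a_1,\ldots,a_k,u_0,\ldots,u_{k-1})$. For a real number $x$, the (homogeneous Diophantine approximation) type is $L(x)=\inf\{c\in\mathbb{R}: |x-\frac{n}{m}|<\frac{c}{m^2} \text{ for some } n,m\in\mathbb{Z},\ m\neq 0\}$. Let $\mathcal{A}=\{p+qi\in\mathbb{C}: p,q\in\mathbb{Q},\ p^2+q^2=1,\ p\neq 0,\ q\neq 0\}$, and let $\mathcal{T}=\{\frac{\arg\alpha}{2\pi}:\alpha\in\mathcal{A}\}$, where $\arg$ denotes the principal argument with values in $(-\pi,\pi]$. A real number $x$ is computable if there is an algorithm which, given any rational $\varepsilon>0$, returns a rational $q$ with $|q-x|<\varepsilon$. *)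

theory Defs
  imports "HOL-Analysis.Analysis" "HOL-Library.Nat_Bijection"
begin

datatype recf = Zero | Succ | Proj nat | Comp recf "recf list" | Prec recf recf | Mini recf

inductive rec_eval :: "recf \<Rightarrow> nat list \<Rightarrow> nat \<Rightarrow> bool" where
  ev_zero: "rec_eval Zero xs 0"
| ev_succ: "rec_eval Succ (x # xs) (Suc x)"
| ev_proj: "k < length xs \<Longrightarrow> rec_eval (Proj k) xs (xs ! k)"
| ev_comp: "length ys = length gs \<Longrightarrow> (\<forall>i < length gs. rec_eval (gs ! i) xs (ys ! i))
            \<Longrightarrow> rec_eval f ys z \<Longrightarrow> rec_eval (Comp f gs) xs z"
| ev_prec0: "rec_eval f xs y \<Longrightarrow> rec_eval (Prec f g) (0 # xs) y"
| ev_precS: "rec_eval (Prec f g) (k # xs) y \<Longrightarrow> rec_eval g (k # y # xs) z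
            \<Longrightarrow> rec_eval (Prec f g) (Suc k # xs) z"
| ev_mini: "rec_eval f (z # xs) 0 \<Longrightarrow> (\<forall>y < z. \<exists>v. rec_eval f (y # xs) v \<and> v > 0)
            \<Longrightarrow> rec_eval (Mini f) xs z"

definition enc_int_list :: "int list \<Rightarrow> nat" where
  "enc_int_list xs = list_encode (map int_encode xs)"

definition enc_rat :: "rat \<Rightarrow> nat" where
  "enc_rat q = (case quotient_of q of (p, d) \<Rightarrow> prod_encode (int_encode p, int_encode d))"

definition dec_rat :: "nat \<Rightarrow> rat" where
  "dec_rat n = (case prod_decode n of (p, d) \<Rightarrow> Fract (int_decode p) (int_decode d))"

definition is_lrs_of :: "int list \<Rightarrow> int list \<Rightarrow> (nat \<Rightarrow> int) \<Rightarrow> bool" where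
  "is_lrs_of a init u \<longleftrightarrow>
     (\<forall>n < length a. u n = init ! n) \<and>
     (\<forall>n. u (n + length a) = (\<Sum>i < length a. a ! i * u (n + length a - 1 - i)))"

text \<open>Valid input of order k: 2k integers (a_1..a_k,u_0..u_{k-1}) with a_k nonzero.\<close>
definition valid_lrs_input :: "nat \<Rightarrow> int list \<Rightarrow> bool" where
  "valid_lrs_input k xs \<longleftrightarrow> length xs = 2 * k \<and> xs ! (k - 1) \<noteq> 0"

definition lrs_positive :: "nat \<Rightarrow> int list \<Rightarrow> bool" where
  "lrs_positive k xs \<longleftrightarrow>
     (\<forall>u. is_lrs_of (take k xs) (drop k xs) u \<longrightarrow> (\<forall>n. u n \<ge> 0))"

definition positivity_decidable :: "nat \<Rightarrow> bool" where
  "positivity_decidable k \<longleftrightarrow>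
     (\<exists>c. \<forall>xs. valid_lrs_input k xs \<longrightarrow>
        rec_eval c [enc_int_list xs] (if lrs_positive k xs then 1 else 0))"

definition computable_real :: "real \<Rightarrow> bool" where
  "computable_real x \<longleftrightarrow>
     (\<exists>c. \<forall>\<epsilon>::rat. \<epsilon> > 0 \<longrightarrow>
        (\<exists>y. rec_eval c [enc_rat \<epsilon>] y \<and> \<bar>of_rat (dec_rat y) - x\<bar> < of_rat \<epsilon>))"

definition dioph_type :: "real \<Rightarrow> real" where
  "dioph_type x = Inf {c. \<exists>n m :: int. m \<noteq> 0 \<and>
       \<bar>x - of_int n / of_int m\<bar> < c / (of_int m)\<^sup>2}"

definition setA :: "complex set" where
  "setA = {Complex (of_rat p) (of_rat q) | p q :: rat. p\<^sup>2 + q\<^sup>2 = 1 \<and> p \<noteq> 0 \<and> q \<noteq> 0}"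

definition setT :: "real set" where
  "setT = {Arg \<alpha> / (2 * pi) | \<alpha>. \<alpha> \<in> setA}"

end

theory Submission
  imports Defs
begin

text \<open>
  Write \<open>t = \<theta> / (2 \<pi>)\<close>, so that \<open>L(t)\<close> is the infimum of the values \<open>m \<bar>m t - n\<bar>\<close> with
  \<open>m > 0\<close>. If the infimum is attained, then \<open>L(t) = m \<bar>m t - n\<bar>\<close> for fixed \<open>m\<close> and \<open>n\<close>. Since
  \<open>cos (m \<theta>)\<close> and \<open>sin (m \<theta>)\<close> are rational, \<open>\<bar>m t - n\<bar>\<close> is a multiple of \<open>1/4\<close> plus
  \<open>arctan x / \<pi>\<close> for a rational \<open>x\<close>, and the arctangent series computes it.

  Otherwise values close to \<open>L(t)\<close> occur only for large \<open>m\<close>, where \<open>tan (\<pi> y) \<approx> \<pi> y\<close> with \<open>y\<close> the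
  distance from \<open>m t\<close> to the integers; as \<open>tan (\<pi> y) \<ge> \<pi> y\<close> always holds, the infimum of
  \<open>m \<bar>tan (m \<theta> / 2)\<bar>\<close> is exactly \<open>\<pi> L(t)\<close>. The bound \<open>a / b \<le> m \<bar>tan (m \<theta> / 2)\<bar>\<close> says that
  \<open>b m (1 - cos (m \<theta>)) \<plusminus> a sin (m \<theta>) \<ge> 0\<close>, which up to a factor \<open>D\<^sup>m\<close> is the positivity of two
  integer recurrence sequences of order 6. Hence the lower cut of \<open>\<pi> L(t)\<close> is decidable.
  No uniformity in \<open>t\<close> is claimed, so the case distinction need not be effective.
\<close>

section \<open>Closure properties of total recursive functions\<close>

text \<open>Totality on all lists of length \<open>k\<close> is built in, so that compositions need
  no domain conditions; lists of other lengths are unconstrained.\<close>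

definition recursive :: "nat \<Rightarrow> (nat list \<Rightarrow> nat) \<Rightarrow> bool" where
  "recursive k f \<longleftrightarrow> (\<exists>c. \<forall>xs. length xs = k \<longrightarrow> rec_eval c xs (f xs))"

lemma recursive_nth: "i < k \<Longrightarrow> recursive k (\<lambda>xs. xs ! i)"
  unfolding recursive_def by (auto intro!: exI[of _ "Proj i"] ev_proj)

lemma rec_eval_Comp1:
  assumes "rec_eval g xs y" "rec_eval f [y] z"
  shows "rec_eval (Comp f [g]) xs z"
  using ev_comp[of "[y]" "[g]" xs f z] assms by simp

lemma rec_eval_Comp2:
  assumes "rec_eval g xs y" "rec_eval g' xs y'" "rec_eval f [y, y'] z"
  shows "rec_eval (Comp f [g, g']) xs z"
  using ev_comp[of "[y, y']" "[g, g']" xs f z] assms by (simp add: less_Suc_eq)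

lemma recursive_comp1:
  assumes "recursive 1 (\<lambda>ys. h (ys ! 0))" "recursive k f"
  shows "recursive k (\<lambda>xs. h (f xs))"
proof -
  obtain c where c0: "\<And>ys. length ys = 1 \<Longrightarrow> rec_eval c ys (h (ys ! 0))"
    using assms(1) unfolding recursive_def by blast
  have c: "rec_eval c [y] (h y)" for y
    using c0[of "[y]"] by simp
  obtain d where d: "\<And>xs. length xs = k \<Longrightarrow> rec_eval d xs (f xs)"
    using assms(2) unfolding recursive_def by blast
  show ?thesis
    unfolding recursive_def using rec_eval_Comp1[OF d c] by blast
qed

lemma recursive_comp2:
  assumes "recursive 2 (\<lambda>ys. h (ys ! 0) (ys ! 1))" "recursive k f" "recursive k g"
  shows "recursive k (\<lambda>xs. h (f xs) (g xs))"
proof -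
  obtain c where c0: "\<And>ys. length ys = 2 \<Longrightarrow> rec_eval c ys (h (ys ! 0) (ys ! 1))"
    using assms(1) unfolding recursive_def by blast
  have c: "rec_eval c [x, y] (h x y)" for x y
    using c0[of "[x, y]"] by simp
  obtain d where d: "\<And>xs. length xs = k \<Longrightarrow> rec_eval d xs (f xs)"
    using assms(2) unfolding recursive_def by blast
  obtain e where e: "\<And>xs. length xs = k \<Longrightarrow> rec_eval e xs (g xs)"
    using assms(3) unfolding recursive_def by blast
  show ?thesis
    unfolding recursive_def using rec_eval_Comp2[OF d e c] by blast
qed

lemma recursive_Suc:
  assumes "recursive k f"
  shows "recursive k (\<lambda>xs. Suc (f xs))"
proof -
  obtain d where d: "\<And>xs. length xs = k \<Longrightarrow> rec_eval d xs (f xs)"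
    using assms unfolding recursive_def by blast
  show ?thesis
    unfolding recursive_def using rec_eval_Comp1[OF d ev_succ] by blast
qed

lemma recursive_const: "recursive k (\<lambda>xs. m)"
proof (induction m)
  case 0
  then show ?case unfolding recursive_def using ev_zero by blast
next
  case (Suc m)
  then show ?case by (rule recursive_Suc)
qed

lemma recursive_prec:
  assumes f: "recursive k f" and g: "recursive (Suc (Suc k)) g"
    and h0: "\<And>xs. length xs = k \<Longrightarrow> h (0 # xs) = f xs"
    and hS: "\<And>n xs. length xs = k \<Longrightarrow> h (Suc n # xs) = g (n # h (n # xs) # xs)"
  shows "recursive (Suc k) h"
proof -
  obtain c where c: "\<And>xs. length xs = k \<Longrightarrow> rec_eval c xs (f xs)"
    using f unfolding recursive_def by blast
  obtain d where d: "\<And>xs. length xs = Suc (Suc k) \<Longrightarrow> rec_eval d xs (g xs)"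
    using g unfolding recursive_def by blast
  have "rec_eval (Prec c d) (n # xs) (h (n # xs))" if "length xs = k" for n xs
  proof (induction n)
    case 0
    then show ?case using c[OF that] h0[OF that] by (simp add: ev_prec0)
  next
    case (Suc n)
    then show ?case using d[of "n # h (n # xs) # xs"] that hS[OF that, of n]
      by (auto intro: ev_precS)
  qed
  then show ?thesis
    unfolding recursive_def by (metis length_Suc_conv)
qed

lemma recursive_prec1:
  assumes g: "recursive 2 (\<lambda>xs. g (xs ! 0) (xs ! 1))"
    and h: "\<And>n. h (Suc n) = g n (h n)"
  shows "recursive 1 (\<lambda>xs. h (xs ! 0))"
  using recursive_prec[OF recursive_const[of 0 "h 0"], of "\<lambda>xs. g (xs ! 0) (xs ! 1)"
      "\<lambda>xs. h (xs ! 0)"] g h by (simp add: numeral_2_eq_2)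

lemma recursive_prec2:
  assumes f: "recursive 1 (\<lambda>xs. f (xs ! 0))"
    and g: "recursive 3 (\<lambda>xs. g (xs ! 0) (xs ! 1) (xs ! 2))"
    and h: "\<And>x. h 0 x = f x" "\<And>n x. h (Suc n) x = g n (h n x) x"
  shows "recursive 2 (\<lambda>xs. h (xs ! 0) (xs ! 1))"
  using recursive_prec[OF f, of "\<lambda>xs. g (xs ! 0) (xs ! 1) (xs ! 2)"
      "\<lambda>xs. h (xs ! 0) (xs ! 1)"] g h by (simp add: numeral_2_eq_2 numeral_3_eq_3)

lemma recursive_add:
  assumes "recursive k f" "recursive k g"
  shows "recursive k (\<lambda>xs. f xs + g xs)"
proof -
  have "recursive 2 (\<lambda>ys. ys ! 0 + ys ! 1)"
    by (rule recursive_prec2[where f = "\<lambda>x. x" and g = "\<lambda>n y x. Suc y"])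
      (auto intro!: recursive_nth recursive_Suc)
  from recursive_comp2[OF this assms] show ?thesis .
qed

lemma recursive_mult:
  assumes "recursive k f" "recursive k g"
  shows "recursive k (\<lambda>xs. f xs * g xs)"
proof -
  have "recursive 2 (\<lambda>ys. ys ! 0 * ys ! 1)"
    by (rule recursive_prec2[where f = "\<lambda>x. 0" and g = "\<lambda>n y x. y + x"])
      (auto intro!: recursive_nth recursive_const recursive_add)
  from recursive_comp2[OF this assms] show ?thesis .
qed

lemma recursive_diff:
  assumes "recursive k f" "recursive k g"
  shows "recursive k (\<lambda>xs. f xs - g xs)"
proof -
  have "recursive 1 (\<lambda>ys. ys ! 0 - Suc 0)"
    by (rule recursive_prec1[where g = "\<lambda>n y. n"]) (auto intro!: recursive_nth)
  then have pred: "recursive k (\<lambda>xs. f xs - Suc 0)" if "recursive k f" for k f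
    using that by (rule recursive_comp1)
  \<comment> \<open>\<open>Prec\<close> recurses on its first argument, which here has to be the
    subtrahend; \<open>assms(2,1)\<close> swaps the arguments back.\<close>
  have "recursive 2 (\<lambda>ys. ys ! 1 - ys ! 0)"
    by (rule recursive_prec2[where f = "\<lambda>x. x" and g = "\<lambda>n y x. y - 1" and h = "\<lambda>n x. x - n"])
      (auto intro!: recursive_nth pred)
  from recursive_comp2[OF this assms(2,1)] show ?thesis .
qed

lemma recursive_power:
  assumes "recursive k f" "recursive k g"
  shows "recursive k (\<lambda>xs. f xs ^ g xs)"
proof -
  have "recursive 2 (\<lambda>ys. ys ! 1 ^ ys ! 0)"
    by (rule recursive_prec2[where f = "\<lambda>x. 1" and g = "\<lambda>n y x. x * y" and h = "\<lambda>n x. x ^ n"])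
      (auto intro!: recursive_nth recursive_const recursive_mult)
  from recursive_comp2[OF this assms(2,1)] show ?thesis .
qed

lemma recursive_triangle:
  assumes "recursive k f"
  shows "recursive k (\<lambda>xs. triangle (f xs))"
proof -
  have "recursive 1 (\<lambda>ys. triangle (ys ! 0))"
    by (rule recursive_prec1[where g = "\<lambda>n y. y + Suc n"])
      (auto intro!: recursive_nth recursive_add recursive_Suc)
  from recursive_comp1[OF this assms] show ?thesis .
qed

lemmas recursive_intros =
  recursive_nth recursive_const recursive_Suc recursive_add recursive_mult recursive_diff
  recursive_power recursive_triangle

lemma recursive_prod_encode:
  assumes "recursive k f" "recursive k g"
  shows "recursive k (\<lambda>xs. prod_encode (f xs, g xs))"
  unfolding prod_encode_def using assms by (auto intro!: recursive_intros)

text \<open>The length of the encoded list is fixed by \<open>fs\<close>, so a fixed number of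
  pairings suffices and no recursion over lists is programmed.\<close>

lemma recursive_list_encode:
  assumes "\<And>f. f \<in> set fs \<Longrightarrow> recursive k f"
  shows "recursive k (\<lambda>xs. list_encode (map (\<lambda>f. f xs) fs))"
  using assms by (induction fs) (auto intro!: recursive_intros recursive_prod_encode)

text \<open>A nonnegative integer \<open>n\<close> has code \<open>2 * n\<close>, a negative one
  \<open>- 2 * n - 1\<close>. Under truncated subtraction the summand for the wrong sign vanishes,
  so no case distinction is left.\<close>

lemma int_encode_diff: "int_encode (int x - int y) = 2 * (x - y) + (2 * (y - x) - 1)"
  by (auto simp: int_encode_def sum_encode_def nat_diff_distrib)

lemma recursive_int_encode_linear:
  assumes "recursive k f" "recursive k g"
  shows "recursive k (\<lambda>xs. int_encode (int (f xs) * c + int (g xs) * d))"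
proof -
  let ?p = "\<lambda>xs. f xs * nat c + g xs * nat d"
  let ?n = "\<lambda>xs. f xs * nat (- c) + g xs * nat (- d)"
  have split: "e = int (nat e) - int (nat (- e))" for e
    by simp
  have "int (f xs) * c + int (g xs) * d = int (?p xs) - int (?n xs)" for xs
    by (subst split[of c], subst split[of d]) (simp only: of_nat_add of_nat_mult algebra_simps)
  then have "(\<lambda>xs. int_encode (int (f xs) * c + int (g xs) * d))
      = (\<lambda>xs. 2 * (?p xs - ?n xs) + (2 * (?n xs - ?p xs) - 1))"
    by (simp only: int_encode_diff)
  then show ?thesis
    using assms by (auto intro!: recursive_intros)
qed

text \<open>Totality of \<open>f\<close> supplies the positive values that \<open>ev_mini\<close>
  requires below the least zero, and \<open>ex\<close> makes the search terminate.\<close>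

lemma recursive_Least:
  assumes f: "recursive (Suc k) f"
    and ex: "\<And>xs. length xs = k \<Longrightarrow> \<exists>z. f (z # xs) = 0"
  shows "recursive k (\<lambda>xs. LEAST z. f (z # xs) = 0)"
proof -
  obtain c where c: "\<And>xs. length xs = Suc k \<Longrightarrow> rec_eval c xs (f xs)"
    using f unfolding recursive_def by blast
  have "rec_eval (Mini c) xs (LEAST z. f (z # xs) = 0)" if xs: "length xs = k" for xs
  proof (rule ev_mini)
    show "rec_eval c ((LEAST z. f (z # xs) = 0) # xs) 0"
      using c[of "(LEAST z. f (z # xs) = 0) # xs"] LeastI_ex[OF ex[OF xs]] xs by simp
    show "\<forall>y<LEAST z. f (z # xs) = 0. \<exists>v. rec_eval c (y # xs) v \<and> 0 < v"
    proof (intro allI impI)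
      fix y assume "y < (LEAST z. f (z # xs) = 0)"
      then have "f (y # xs) \<noteq> 0" by (rule not_less_Least)
      then show "\<exists>v. rec_eval c (y # xs) v \<and> 0 < v"
        using c[of "y # xs"] xs by auto
    qed
  qed
  then show ?thesis unfolding recursive_def by blast
qed

section \<open>Reals with recursive rational approximations\<close>

text \<open>Quotients of natural numbers avoid signs and suffice, as only nonnegative reals occur.
  The constant \<open>C\<close> and the index from which the bound holds need only exist.\<close>

definition approximable :: "real \<Rightarrow> bool" where
  "approximable x \<longleftrightarrow> (\<exists>p q C. recursive 1 (\<lambda>xs. p (xs ! 0)) \<and> recursive 1 (\<lambda>xs. q (xs ! 0)) \<and>
     (\<forall>\<^sub>F N in sequentially. q N > 0 \<and> \<bar>real (p N) / real (q N) - x\<bar> \<le> C / real N))"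

lemma approximableI:
  assumes "recursive 1 (\<lambda>xs. p (xs ! 0))" "recursive 1 (\<lambda>xs. q (xs ! 0))"
    and "\<forall>\<^sub>F N in sequentially. q N > 0 \<and> \<bar>real (p N) / real (q N) - x\<bar> \<le> C / real N"
  shows "approximable x"
  using assms unfolding approximable_def by blast

text \<open>The code of \<open>\<epsilon>\<close> bounds its denominator, so that a program can use the code itself as the
  required precision and never has to decode it.\<close>

lemma inverse_enc_rat_less:
  assumes "\<epsilon> > 0"
  shows "1 / real (Suc (enc_rat \<epsilon>)) < of_rat \<epsilon>"
proof -
  obtain p d where pd: "quotient_of \<epsilon> = (p, d)" by fastforce
  have d: "d > 0" using quotient_of_denom_pos[OF pd] .
  have eps: "\<epsilon> = of_int p / of_int d" using quotient_of_div[OF pd] .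
  have p: "p \<ge> 1" using assms d unfolding eps by (simp add: zero_less_divide_iff)
  have "nat d \<le> int_encode d"
    using d by (simp add: int_encode_def sum_encode_def)
  also have "\<dots> \<le> enc_rat \<epsilon>"
    unfolding enc_rat_def pd by (simp add: le_prod_encode_2)
  finally have "real_of_int d < real (Suc (enc_rat \<epsilon>))"
    using d by linarith
  then have "1 / real (Suc (enc_rat \<epsilon>)) < 1 / real_of_int d"
    using d by (intro divide_strict_left_mono) auto
  also have "\<dots> \<le> real_of_int p / real_of_int d"
    using p d by (intro divide_right_mono) auto
  also have "\<dots> = of_rat \<epsilon>"
    by (simp add: eps of_rat_divide)
  finally show ?thesis .
qed

text \<open>Nonnegative integers have even codes. The fraction need not be in lowest terms, and for
  \<open>b = 0\<close> both sides are 0.\<close>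

lemma dec_rat_prod_encode: "real_of_rat (dec_rat (prod_encode (2 * a, 2 * b))) = real a / real b"
proof -
  have "int_decode (2 * n) = int n" for n
    using int_encode_inverse[of "int n"] by (simp add: int_encode_def sum_encode_def)
  then have "dec_rat (prod_encode (2 * a, 2 * b)) = of_nat a / of_nat b"
    by (simp add: dec_rat_def Fract_of_int_quotient)
  then show ?thesis by (simp add: of_rat_divide)
qed

text \<open>The threshold \<open>N0\<close> and a natural bound \<open>K\<close> of \<open>C\<close>
  are hardwired into the program. At index \<open>N0 + K * Suc e\<close> the error is at most
  \<open>1 / Suc e\<close>, which is below \<epsilon> when \<open>e\<close> is its code.\<close>

lemma approximable_imp_computable_real:
  assumes "approximable x"
  shows "computable_real x"
proof -
  obtain p q C where p: "recursive 1 (\<lambda>xs. p (xs ! 0))" and q: "recursive 1 (\<lambda>xs. q (xs ! 0))"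
    and ev: "\<forall>\<^sub>F N in sequentially. q N > 0 \<and> \<bar>real (p N) / real (q N) - x\<bar> \<le> C / real N"
    using assms unfolding approximable_def by blast
  obtain N0 where N0: "\<And>N. N \<ge> N0 \<Longrightarrow> \<bar>real (p N) / real (q N) - x\<bar> \<le> C / real N"
    using ev unfolding eventually_sequentially by blast
  obtain K :: nat where K: "C \<le> real K" "K > 0"
    using real_arch_simple[of "max C 1"] by auto
  define F where "F e = N0 + K * Suc e" for e
  have err: "\<bar>real (p (F e)) / real (q (F e)) - x\<bar> \<le> 1 / real (Suc e)" for e
  proof -
    have pos: "real (F e) > 0" using K by (simp add: F_def add_nonneg_pos add_pos_nonneg)
    have "\<bar>real (p (F e)) / real (q (F e)) - x\<bar> \<le> C / real (F e)"
      by (rule N0) (simp add: F_def)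
    also have "\<dots> \<le> real K / real (F e)"
      using K pos by (intro divide_right_mono) auto
    also have "\<dots> \<le> real K / real (K * Suc e)"
      using K pos by (intro divide_left_mono mult_pos_pos) (auto simp: F_def add_pos_nonneg)
    also have "\<dots> = 1 / real (Suc e)" using K by (simp del: of_nat_Suc mult_Suc_right)
    finally show ?thesis .
  qed
  have "recursive 1 (\<lambda>xs. prod_encode (2 * p (F (xs ! 0)), 2 * q (F (xs ! 0))))"
    unfolding F_def
    by (intro recursive_prod_encode recursive_intros recursive_comp1[OF p] recursive_comp1[OF q]) auto
  then obtain c where c0: "\<And>xs. length xs = 1 \<Longrightarrow>
      rec_eval c xs (prod_encode (2 * p (F (xs ! 0)), 2 * q (F (xs ! 0))))"
    unfolding recursive_def by blast
  have c: "rec_eval c [e] (prod_encode (2 * p (F e), 2 * q (F e)))" for e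
    using c0[of "[e]"] by simp
  show ?thesis
    unfolding computable_real_def
  proof (intro exI[of _ c] allI impI)
    fix \<epsilon> :: rat assume "\<epsilon> > 0"
    then show "\<exists>y. rec_eval c [enc_rat \<epsilon>] y \<and> \<bar>of_rat (dec_rat y) - x\<bar> < of_rat \<epsilon>"
      using c[of "enc_rat \<epsilon>"] err[of "enc_rat \<epsilon>"] inverse_enc_rat_less[of \<epsilon>]
      by (intro exI conjI) (auto simp: dec_rat_prod_encode simp del: of_nat_Suc)
  qed
qed


lemma approximable_affine:
  assumes "approximable x" "d > 0"
  shows "approximable ((real c + real m * x) / real d)"
proof -
  obtain p q C where p: "recursive 1 (\<lambda>xs. p (xs ! 0))" and q: "recursive 1 (\<lambda>xs. q (xs ! 0))"
    and ev: "\<forall>\<^sub>F N in sequentially. q N > 0 \<and> \<bar>real (p N) / real (q N) - x\<bar> \<le> C / real N"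
    using assms unfolding approximable_def by blast
  have "\<forall>\<^sub>F N in sequentially. d * q N > 0 \<and>
      \<bar>real (c * q N + m * p N) / real (d * q N) - (real c + real m * x) / real d\<bar>
        \<le> (real m * C / real d) / real N"
    using ev
  proof eventually_elim
    case (elim N)
    have "real (c * q N + m * p N) / real (d * q N) - (real c + real m * x) / real d
        = real m / real d * (real (p N) / real (q N) - x)"
      using elim assms(2) by (simp add: field_simps)
    then have "\<bar>real (c * q N + m * p N) / real (d * q N) - (real c + real m * x) / real d\<bar>
        = real m / real d * \<bar>real (p N) / real (q N) - x\<bar>"
      by (simp add: abs_mult)
    also have "\<dots> \<le> real m / real d * (C / real N)"
      using elim by (intro mult_left_mono) auto
    finally show ?case using elim assms(2) by simp
  qed
  moreover have "recursive 1 (\<lambda>xs. c * q (xs ! 0) + m * p (xs ! 0))"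
    "recursive 1 (\<lambda>xs. d * q (xs ! 0))"
    by (intro recursive_intros p q)+
  ultimately show ?thesis by (intro approximableI)
qed

lemma approximable_divide:
  assumes "approximable x" "approximable y" "y > 0"
  shows "approximable (x / y)"
proof -
  obtain p q C where p: "recursive 1 (\<lambda>xs. p (xs ! 0))" and q: "recursive 1 (\<lambda>xs. q (xs ! 0))"
    and ev: "\<forall>\<^sub>F N in sequentially. q N > 0 \<and> \<bar>real (p N) / real (q N) - x\<bar> \<le> C / real N"
    using assms(1) unfolding approximable_def by blast
  obtain p' q' C' where p': "recursive 1 (\<lambda>xs. p' (xs ! 0))"
    and q': "recursive 1 (\<lambda>xs. q' (xs ! 0))"
    and ev': "\<forall>\<^sub>F N in sequentially. q' N > 0 \<and> \<bar>real (p' N) / real (q' N) - y\<bar> \<le> C' / real N"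
    using assms(2) unfolding approximable_def by blast
  \<comment> \<open>Keeps the approximations to \<open>y\<close> above \<open>y / 2\<close>, which
    bounds the error of the quotient.\<close>
  have ev2: "\<forall>\<^sub>F N in sequentially. C' / real N < y / 2"
    using lim_const_over_n[of C'] assms(3) by (intro order_tendstoD) auto
  have "\<forall>\<^sub>F N in sequentially. q N * p' N > 0 \<and>
      \<bar>real (p N * q' N) / real (q N * p' N) - x / y\<bar>
        \<le> ((C * y + \<bar>x\<bar> * C') / (y / 2 * y)) / real N"
    using ev ev' ev2
  proof eventually_elim
    case (elim N)
    define X where "X = real (p N) / real (q N)"
    define Y where "Y = real (p' N) / real (q' N)"
    have dX: "\<bar>X - x\<bar> \<le> C / real N" and dY: "\<bar>Y - y\<bar> \<le> C' / real N"
      using elim by (auto simp: X_def Y_def)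
    have Y: "Y > y / 2" using dY elim by linarith
    then have "Y > 0" using assms(3) by simp
    then have p'0: "p' N > 0" unfolding Y_def by (cases "p' N") auto
    have "\<bar>X / Y - x / y\<bar> = \<bar>(X - x) * y + x * (y - Y)\<bar> / (Y * y)"
      using \<open>Y > 0\<close> assms(3) by (simp add: field_simps abs_mult)
    also have "\<dots> \<le> (\<bar>X - x\<bar> * y + \<bar>x\<bar> * \<bar>Y - y\<bar>) / (Y * y)"
      using \<open>Y > 0\<close> assms(3) abs_triangle_ineq[of "(X - x) * y" "x * (y - Y)"]
      by (intro divide_right_mono) (auto simp: abs_mult abs_minus_commute)
    also have "\<dots> \<le> (\<bar>X - x\<bar> * y + \<bar>x\<bar> * \<bar>Y - y\<bar>) / (y / 2 * y)"
      using Y \<open>Y > 0\<close> assms(3) by (intro divide_left_mono mult_right_mono) auto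
    also have "\<dots> \<le> (C / real N * y + \<bar>x\<bar> * (C' / real N)) / (y / 2 * y)"
      using dX dY assms(3) by (intro divide_right_mono add_mono mult_right_mono mult_left_mono) auto
    also have "\<dots> = ((C * y + \<bar>x\<bar> * C') / (y / 2 * y)) / real N"
      by (simp add: add_divide_distrib ac_simps)
    finally show ?case
      using elim p'0 by (simp add: X_def Y_def)
  qed
  moreover have "recursive 1 (\<lambda>xs. p (xs ! 0) * q' (xs ! 0))"
    "recursive 1 (\<lambda>xs. q (xs ! 0) * p' (xs ! 0))"
    by (intro recursive_intros p q p' q')+
  ultimately show ?thesis by (intro approximableI)
qed

section \<open>Series, arctangents and angles with rational sine and cosine\<close>

text \<open>Over the unreduced common denominator, the product of the \<open>w k\<close>, the
  numerators of the partial sums satisfy a primitive recursion.\<close>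

lemma approximable_partial_sums:
  assumes v: "recursive 1 (\<lambda>xs. v (xs ! 0))" and w: "recursive 1 (\<lambda>xs. w (xs ! 0))"
    and pos: "\<And>k. w k > 0"
    and lim: "\<And>n. n > 0 \<Longrightarrow> \<bar>(\<Sum>k<n. real (v k) / real (w k)) - x\<bar> \<le> C / real n"
  shows "approximable x"
proof -
  define q where "q n = (\<Prod>k<n. w k)" for n
  define p where "p = rec_nat 0 (\<lambda>n y. y * w n + v n * q n)"
  have q_pos: "q n > 0" for n
    using pos by (simp add: q_def)
  have pq: "real (p n) / real (q n) = (\<Sum>k<n. real (v k) / real (w k))" for n
  proof (induction n)
    case (Suc n)
    have "real (p (Suc n)) / real (q (Suc n)) = real (p n) / real (q n) + real (v n) / real (w n)"
      using q_pos[of n] pos[of n] by (simp add: p_def q_def field_simps)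
    then show ?case using Suc by simp
  qed (simp add: p_def q_def)
  have q: "recursive 1 (\<lambda>xs. q (xs ! 0))"
    by (rule recursive_prec1[where g = "\<lambda>n y. y * w n"])
      (auto simp: q_def intro!: recursive_intros recursive_comp1[OF w])
  have p: "recursive 1 (\<lambda>xs. p (xs ! 0))"
    by (rule recursive_prec1[where g = "\<lambda>n y. y * w n + v n * q n"])
      (auto simp: p_def intro!: recursive_intros recursive_comp1[OF w] recursive_comp1[OF v]
        recursive_comp1[OF q])
  have "\<forall>\<^sub>F N in sequentially. q N > 0 \<and> \<bar>real (p N) / real (q N) - x\<bar> \<le> C / real N"
    using eventually_gt_at_top[of 0] by eventually_elim (use lim q_pos pq in auto)
  with p q show ?thesis by (rule approximableI)
qed

text \<open>Consecutive terms of the alternating arctangent series are paired, which makes every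
  summand a quotient of natural numbers.\<close>

lemma approximable_arctan:
  assumes "a \<le> b" "b > 0"
  shows "approximable (arctan (real a / real b))"
proof (rule approximable_partial_sums)
  let ?v = "\<lambda>k. a ^ (4 * k + 1) * b ^ 2 * (4 * k + 3) - a ^ (4 * k + 3) * (4 * k + 1)"
  let ?w = "\<lambda>k. b ^ (4 * k + 3) * (4 * k + 1) * (4 * k + 3)"
  define x where "x = real a / real b"
  define f where "f = (\<lambda>n. 1 / real (n * 2 + 1) * x ^ (n * 2 + 1))"
  have x: "0 \<le> x" "x \<le> 1" using assms by (auto simp: x_def)
  show "recursive 1 (\<lambda>xs. ?v (xs ! 0))" "recursive 1 (\<lambda>xs. ?w (xs ! 0))"
    by (intro recursive_intros; simp)+
  show "?w k > 0" for k using assms by simp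
  show "\<bar>(\<Sum>k<n. real (?v k) / real (?w k)) - arctan (real a / real b)\<bar> \<le> 1 / real n"
    if "n > 0" for n
  proof -
    \<comment> \<open>Here \<open>a \<le> b\<close> makes the truncated subtraction in
      \<open>?v\<close> exact.\<close>
    have le: "a ^ (4 * k + 3) * (4 * k + 1) \<le> a ^ (4 * k + 1) * b ^ 2 * (4 * k + 3)" for k
    proof -
      have "a ^ (4 * k + 3) * (4 * k + 1) = a ^ (4 * k + 1) * a ^ 2 * (4 * k + 1)"
        by (simp add: power_add numeral_eq_Suc)
      also have "\<dots> \<le> a ^ (4 * k + 1) * b ^ 2 * (4 * k + 3)"
        using assms by (intro mult_mono power_mono) auto
      finally show ?thesis .
    qed
    have term_eq: "real (?v k) / real (?w k) = f (2 * k) - f (Suc (2 * k))" for k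
    proof -
      have "real (?v k) / real (?w k) = (real a ^ (4 * k + 1) * real b ^ 2 * real (4 * k + 3)
          - real a ^ (4 * k + 3) * real (4 * k + 1)) / real (?w k)"
        by (subst of_nat_diff[OF le]) (simp only: of_nat_mult of_nat_power)
      also have "\<dots> = (real a ^ (4 * k + 1) * real b ^ 2 * real (4 * k + 3)) / real (?w k)
          - real a ^ (4 * k + 3) * real (4 * k + 1) / real (?w k)"
        by (rule diff_divide_distrib)
      also have "(real a ^ (4 * k + 1) * real b ^ 2 * real (4 * k + 3)) / real (?w k)
          = real a ^ (4 * k + 1) / (real b ^ (4 * k + 1) * real (4 * k + 1))"
      proof -
        have "4 * k + 3 = 4 * k + 1 + 2" by simp
        then have "b ^ (4 * k + 3) = b ^ (4 * k + 1) * b ^ 2" by (metis power_add)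
        then have "real (?w k)
            = real b ^ (4 * k + 1) * real b ^ 2 * real (4 * k + 1) * real (4 * k + 3)"
          by (simp only: of_nat_mult of_nat_power)
        moreover have "A * B * r / (P * B * s * r) = A / (P * s)" if "B \<noteq> 0" "r \<noteq> 0"
          for A B P r s :: real using that by simp
        ultimately show ?thesis using assms by simp
      qed
      also have "\<dots> = f (2 * k)"
      proof -
        have "2 * k * 2 + 1 = 4 * k + 1" by simp
        then show ?thesis unfolding f_def x_def power_divide by simp
      qed
      also have "real a ^ (4 * k + 3) * real (4 * k + 1) / real (?w k)
          = real a ^ (4 * k + 3) / (real b ^ (4 * k + 3) * real (4 * k + 3))"
      proof -
        have "A * s / (P * s * r) = A / (P * r)" if "s \<noteq> 0" for A P r s :: real
          using that by simp
        then show ?thesis unfolding of_nat_mult of_nat_power by simp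
      qed
      also have "\<dots> = f (Suc (2 * k))"
      proof -
        have "Suc (2 * k) * 2 + 1 = 4 * k + 3" by simp
        then show ?thesis
          unfolding f_def x_def power_divide by (simp only: times_divide_times_eq mult_1 mult.commute)
      qed
      finally show ?thesis .
    qed
    have sums: "(\<Sum>k<n. real (?v k) / real (?w k)) = (\<Sum>i<2 * n. (- 1) ^ i * f i)"
      unfolding term_eq by (induction n) simp_all
    have arctan: "arctan x = (\<Sum>i. (- 1) ^ i * f i)"
      using arctan_series[of x] x by (simp add: f_def)
    have f0: "f \<longlonglongrightarrow> 0"
      using zeroseq_arctan_series[of x] x by (simp add: f_def)
    have f_pos: "0 \<le> f i" for i
      using x by (simp add: f_def)
    have f_mono: "f (Suc i) \<le> f i" for i
      unfolding f_def using x by (intro mult_mono power_decreasing) (auto intro!: divide_left_mono)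
    \<comment> \<open>By the Leibniz criterion the limit lies between two consecutive partial sums,
      so the error is at most the first omitted term \<open>f (2 * n)\<close>.\<close>
    have lower: "(\<Sum>i<2 * n. (- 1) ^ i * f i) \<le> arctan x"
      unfolding arctan by (rule summable_Leibniz'(2)[OF f0 f_pos f_mono])
    have "arctan x \<le> (\<Sum>i<2 * n + 1. (- 1) ^ i * f i)"
      unfolding arctan by (rule summable_Leibniz'(4)[OF f0 f_pos f_mono])
    then have upper: "arctan x \<le> (\<Sum>i<2 * n. (- 1) ^ i * f i) + f (2 * n)"
      by simp
    have "f (2 * n) \<le> 1 / real (2 * n * 2 + 1) * 1"
      unfolding f_def using x by (intro mult_left_mono power_le_one) auto
    also have "\<dots> \<le> 1 / real n"
      using that by (simp add: frac_le)
    finally show ?thesis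
      using lower upper unfolding sums x_def by linarith
  qed
qed


text \<open>Removing \<open>k\<close> quarter turns keeps sine and cosine rational and leaves
  \<open>pi * z\<close> below \<open>pi / 4\<close>. Its tangent is rational by the half-angle
  formula and lies in [0, 1), where the arctangent series is available.\<close>

lemma approximable_if_rational_cos_sin:
  assumes "y \<ge> 0" "cos (2 * pi * y) \<in> \<rat>" "sin (2 * pi * y) \<in> \<rat>"
  shows "approximable y"
proof -
  define k where "k = nat \<lfloor>4 * y\<rfloor>"
  define z where "z = y - real k / 4"
  have "real k = of_int \<lfloor>4 * y\<rfloor>"
    using assms(1) by (simp add: k_def)
  then have z: "0 \<le> z" "z < 1 / 4"
    unfolding z_def by linarith+
  have rot: "cos (2 * pi * y - real j * (pi / 2)) \<in> \<rat> \<and> sin (2 * pi * y - real j * (pi / 2)) \<in> \<rat>" for j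
  proof (induction j)
    case 0
    then show ?case using assms by simp
  next
    case (Suc j)
    have "2 * pi * y - real (Suc j) * (pi / 2) = (2 * pi * y - real j * (pi / 2)) - pi / 2"
      by (simp add: algebra_simps)
    moreover have "cos (\<phi> - pi / 2) = sin \<phi>" "sin (\<phi> - pi / 2) = - cos \<phi>" for \<phi> :: real
      by (simp_all add: cos_diff sin_diff)
    ultimately show ?case
      using Suc by (simp only: Rats_minus_iff)
  qed
  have "2 * pi * z = 2 * pi * y - real k * (pi / 2)"
    by (simp add: z_def algebra_simps)
  then have rat: "cos (2 * (pi * z)) \<in> \<rat>" "sin (2 * (pi * z)) \<in> \<rat>"
    using rot[of k] by (auto simp: mult.assoc)
  define x where "x = tan (pi * z)"
  have "pi * z < pi * (1 / 4)"
    using z by (intro mult_strict_left_mono) auto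
  then have pz: "0 \<le> pi * z" "pi * z < pi / 4"
    using z by auto
  have "x \<in> \<rat>"
    unfolding x_def tan_half by (intro Rats_divide Rats_add rat Rats_1)
  then obtain a b where "b \<noteq> 0" and ab: "\<bar>x\<bar> = real a / real b"
    by (rule Rats_abs_nat_div_natE)
  have "0 \<le> x" unfolding x_def using pz by (intro tan_pos_pi2_le) auto
  have "x < 1" unfolding x_def using pz tan_monotone[of "pi * z" "pi / 4"] by (simp add: tan_45)
  have x: "x = real a / real b" using ab \<open>0 \<le> x\<close> by simp
  have "a \<le> b" using \<open>x < 1\<close> \<open>b \<noteq> 0\<close> unfolding x by (simp add: field_simps)
  have "arctan x = pi * z"
    unfolding x_def using pz pi_gt_zero by (intro arctan_tan) linarith+
  \<comment> \<open>As \<open>arctan 1 = pi / 4\<close>, the quotient is \<open>4 * z\<close>; the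
    same series thus also supplies the approximation to pi.\<close>
  then have y: "y = (real k + real 1 * (arctan x / arctan 1)) / real 4"
    by (simp add: arctan_one z_def field_simps)
  have "approximable (arctan (real 1 / real 1))"
    by (rule approximable_arctan) auto
  then have "approximable (arctan x / arctan 1)"
    using approximable_arctan[OF \<open>a \<le> b\<close>] \<open>b \<noteq> 0\<close> unfolding x
    by (intro approximable_divide) (auto simp: arctan_one)
  then show ?thesis
    unfolding y by (rule approximable_affine) simp
qed

section \<open>The Diophantine approximation type\<close>

text \<open>Multiplying by the squared denominator clears fractions, and moving the sign of the
  denominator into \<open>n\<close> makes it a positive natural number.\<close>

lemma dioph_type_eq_Inf:
  "dioph_type x = Inf {c. \<exists>(n::int) (m::nat). m > 0 \<and> real m * \<bar>real m * x - of_int n\<bar> < c}"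
proof -
  have eq: "\<bar>x - of_int n / of_int m\<bar> < c / (of_int m)\<^sup>2 \<longleftrightarrow>
      real (nat \<bar>m\<bar>) * \<bar>real (nat \<bar>m\<bar>) * x - of_int (sgn m * n)\<bar> < c"
    if "m \<noteq> 0" for n m :: int and c
  proof -
    have "\<bar>x - of_int n / of_int m\<bar> < c / (of_int m)\<^sup>2 \<longleftrightarrow>
        (of_int m)\<^sup>2 * \<bar>x - of_int n / of_int m\<bar> < c"
      using that by (simp add: field_simps)
    also have "(of_int m)\<^sup>2 * \<bar>x - of_int n / of_int m\<bar>
        = \<bar>of_int m\<bar> * \<bar>of_int m * (x - of_int n / of_int m)\<bar>"
      by (simp add: abs_mult power2_eq_square)
    also have "of_int m * (x - of_int n / of_int m) = of_int m * x - of_int n"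
      using that by (simp add: field_simps)
    also have "\<bar>of_int m * x - of_int n\<bar> = \<bar>real (nat \<bar>m\<bar>) * x - of_int (sgn m * n)\<bar>"
      using that by (auto simp: sgn_if abs_if)
    finally show ?thesis by simp
  qed
  have "(\<exists>n m :: int. m \<noteq> 0 \<and> \<bar>x - of_int n / of_int m\<bar> < c / (of_int m)\<^sup>2) \<longleftrightarrow>
      (\<exists>(n::int) (m::nat). m > 0 \<and> real m * \<bar>real m * x - of_int n\<bar> < c)" (is "?L \<longleftrightarrow> ?R") for c
  proof
    assume ?L
    then obtain n m :: int where "m \<noteq> 0" "\<bar>x - of_int n / of_int m\<bar> < c / (of_int m)\<^sup>2" by blast
    then show ?R using eq[of m n c] by (intro exI[of _ "sgn m * n"] exI[of _ "nat \<bar>m\<bar>"]) auto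
  next
    assume ?R
    then obtain n :: int and m :: nat where "m > 0" "real m * \<bar>real m * x - of_int n\<bar> < c" by blast
    then show ?L using eq[of "int m" n c] by (intro exI[of _ n] exI[of _ "int m"]) auto
  qed
  then show ?thesis unfolding dioph_type_def by simp
qed

text \<open>The infimum is over strict upper bounds \<open>c\<close>, so the value itself is reached
  through \<open>c\<close> exceeding it by an arbitrary \<open>e > 0\<close>.\<close>

lemma dioph_type_le:
  assumes "m > 0"
  shows "dioph_type x \<le> real m * \<bar>real m * x - of_int n\<bar>"
proof (rule field_le_epsilon)
  fix e :: real assume "e > 0"
  have "bdd_below {c. \<exists>(n::int) (m::nat). m > 0 \<and> real m * \<bar>real m * x - of_int n\<bar> < c}"
  proof (rule bdd_belowI[of _ 0], clarify)
    fix c n and m :: nat assume "real m * \<bar>real m * x - of_int n\<bar> < c"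
    moreover have "real m * \<bar>real m * x - of_int n\<bar> \<ge> 0" by simp
    ultimately show "0 \<le> c" by linarith
  qed
  moreover have "real m * \<bar>real m * x - of_int n\<bar> < real m * \<bar>real m * x - of_int n\<bar> + e"
    using \<open>e > 0\<close> by simp
  ultimately show "dioph_type x \<le> real m * \<bar>real m * x - of_int n\<bar> + e"
    unfolding dioph_type_eq_Inf using assms by (intro cInf_lower) blast+
qed

lemma dioph_type_lessD:
  assumes "dioph_type x < c"
  shows "\<exists>(n::int) (m::nat). m > 0 \<and> real m * \<bar>real m * x - of_int n\<bar> < c"
proof -
  have "{c. \<exists>(n::int) (m::nat). m > 0 \<and> real m * \<bar>real m * x - of_int n\<bar> < c} \<noteq> {}"
    using lt_ex gt_ex zero_less_one by fastforce
  from cInf_lessD[OF this assms[unfolded dioph_type_eq_Inf]] obtain d n and m :: nat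
    where "m > 0" "real m * \<bar>real m * x - of_int n\<bar> < d" "d < c" by blast
  then show ?thesis by (intro exI[of _ n] exI[of _ m]) auto
qed

lemma dioph_type_nonneg: "dioph_type x \<ge> 0"
proof (rule ccontr)
  assume "\<not> 0 \<le> dioph_type x"
  then obtain n :: int and m :: nat where "real m * \<bar>real m * x - of_int n\<bar> < 0"
    using dioph_type_lessD[of x 0] by auto
  moreover have "real m * \<bar>real m * x - of_int n\<bar> \<ge> 0" by simp
  ultimately show False by linarith
qed

text \<open>For each positive \<open>m \<le> N\<close> the best value \<open>w m\<close>, taken at
  the nearest integer, is strictly above the type. So is the minimum \<delta> of these finitely many
  values and \<open>c\<close>, and any pair with value below \<delta> has
  \<open>m > N\<close>.\<close>

lemma dioph_type_large_denominator:
  assumes not_attained: "\<And>(n::int) (m::nat). m > 0 \<Longrightarrow> dioph_type x \<noteq> real m * \<bar>real m * x - of_int n\<bar>"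
    and c: "dioph_type x < c"
  shows "\<exists>(n::int) (m::nat). m > N \<and> real m * \<bar>real m * x - of_int n\<bar> < c"
proof -
  define w where "w m = real m * \<bar>real m * x - of_int (round (real m * x))\<bar>" for m :: nat
  define \<delta> where "\<delta> = Min (insert c (w ` {1..N}))"
  have "dioph_type x < w m" if "m > 0" for m
    using dioph_type_le[OF that, of x "round (real m * x)"] not_attained[OF that, of "round (real m * x)"]
    unfolding w_def by linarith
  then have "dioph_type x < \<delta>"
    using c unfolding \<delta>_def by (subst Min_gr_iff) auto
  then obtain n :: int and m :: nat where m: "m > 0" and nm: "real m * \<bar>real m * x - of_int n\<bar> < \<delta>"
    using dioph_type_lessD by blast
  have "w m \<le> real m * \<bar>real m * x - of_int n\<bar>"
    unfolding w_def by (intro mult_left_mono round_diff_minimal) auto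
  then have "w m < \<delta>" using nm by simp
  moreover have "\<delta> \<le> w m" if "m \<le> N"
    unfolding \<delta>_def using that m by (intro Min_le) auto
  ultimately have "m > N" by force
  moreover have "\<delta> \<le> c" unfolding \<delta>_def by (intro Min_le) auto
  ultimately show ?thesis using nm by (intro exI[of _ n] exI[of _ m]) auto
qed


section \<open>Recurrence sequences and positivity queries\<close>

text \<open>Allows the quantifier over all sequences in \<open>lrs_positive\<close> to be replaced
  by one explicit sequence.\<close>

lemma is_lrs_of_unique:
  assumes "is_lrs_of a init u" "is_lrs_of a init v"
  shows "u n = v n"
proof (induction n rule: less_induct)
  case (less n)
  show ?case
  proof (cases "n < length a")
    case True
    then show ?thesis using assms by (simp add: is_lrs_of_def)
  next
    case False
    define k where "k = n - length a"
    have n: "n = k + length a" using False by (simp add: k_def)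
    have "u n = (\<Sum>i<length a. a ! i * u (k + length a - 1 - i))"
      "v n = (\<Sum>i<length a. a ! i * v (k + length a - 1 - i))"
      using assms unfolding n is_lrs_of_def by blast+
    moreover have "u (k + length a - 1 - i) = v (k + length a - 1 - i)" if "i < length a" for i
      by (rule less.IH) (use that n in linarith)
    ultimately show ?thesis by simp
  qed
qed

lemma lrs_positive_iff:
  assumes "is_lrs_of (take k xs) (drop k xs) u"
  shows "lrs_positive k xs \<longleftrightarrow> (\<forall>n. u n \<ge> 0)"
  using is_lrs_of_unique[OF assms] assms unfolding lrs_positive_def by metis

text \<open>The real and imaginary parts of the powers of the Gaussian integer
  \<open>A + B i\<close>.\<close>

primrec gauss_power :: "int \<Rightarrow> int \<Rightarrow> nat \<Rightarrow> int \<times> int" where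
  "gauss_power A B 0 = (1, 0)"
| "gauss_power A B (Suc n) =
    (let (X, Y) = gauss_power A B n in (A * X - B * Y, B * X + A * Y))"

lemma gauss_power_cos_sin:
  assumes "of_int A = of_int D * cos \<theta>" "of_int B = of_int D * sin (\<theta> :: real)"
  shows "of_int (fst (gauss_power A B n)) = of_int D ^ n * cos (real n * \<theta>) \<and>
    of_int (snd (gauss_power A B n)) = of_int D ^ n * sin (real n * \<theta>)"
proof (induction n)
  case (Suc n)
  have "real (Suc n) * \<theta> = real n * \<theta> + \<theta>" by (simp add: algebra_simps)
  then show ?case
    using Suc assms by (simp add: case_prod_beta Let_def cos_add sin_add algebra_simps)
qed simp

text \<open>\<open>A + B i\<close> and its conjugate are the roots of
  \<open>x^2 - 2 A x + D^2\<close>.\<close>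

lemma gauss_power_recurrence:
  assumes "A\<^sup>2 + B\<^sup>2 = D\<^sup>2"
  shows "fst (gauss_power A B (Suc (Suc n)))
      = 2 * A * fst (gauss_power A B (Suc n)) - D\<^sup>2 * fst (gauss_power A B n)"
    "snd (gauss_power A B (Suc (Suc n)))
      = 2 * A * snd (gauss_power A B (Suc n)) - D\<^sup>2 * snd (gauss_power A B n)"
  unfolding assms[symmetric] by (simp_all add: case_prod_beta Let_def algebra_simps power2_eq_square)

text \<open>The coefficients of the recurrence with characteristic polynomial
  \<open>(x - D)\<^sup>2 (x\<^sup>2 - 2 A x + D\<^sup>2)\<^sup>2\<close>.\<close>

definition double_root_coeffs :: "int \<Rightarrow> int \<Rightarrow> int list" where
  "double_root_coeffs A D =
    [4 * A + 2 * D, - (4 * A\<^sup>2 + 8 * A * D + 3 * D\<^sup>2), 8 * A * D\<^sup>2 + 8 * A\<^sup>2 * D + 4 * D ^ 3,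
     - (4 * A\<^sup>2 * D\<^sup>2 + 8 * A * D ^ 3 + 3 * D ^ 4), 4 * A * D ^ 4 + 2 * D ^ 5, - (D ^ 6)]"

text \<open>Double roots account for the factor \<open>n\<close>. Rewriting everything in terms of
  \<open>D ^ n\<close> and two consecutive values each of \<open>X\<close> and \<open>Y\<close>
  leaves a polynomial identity.\<close>

lemma is_lrs_of_double_root:
  assumes X: "\<And>n. X (Suc (Suc n)) = 2 * A * X (Suc n) - D\<^sup>2 * X n"
    and Y: "\<And>n. Y (Suc (Suc n)) = 2 * A * Y (Suc n) - D\<^sup>2 * Y n"
    and u: "\<And>n. u n = b * (int n * (D ^ n - X n)) + a * Y n"
  shows "is_lrs_of (double_root_coeffs A D) (map u [0..<6]) u"
proof -
  have len: "length (double_root_coeffs A D) = 6" by (simp add: double_root_coeffs_def)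
  have "u (n + 6) = (\<Sum>i<6. double_root_coeffs A D ! i * u (n + 6 - 1 - i))" for n
    by (simp add: double_root_coeffs_def eval_nat_numeral u X Y algebra_simps)
  then show ?thesis
    unfolding is_lrs_of_def len by simp
qed

text \<open>Only the initial values depend on the arguments, and they do so linearly, so the code of
  the query is a recursive function of them.\<close>

lemma recursive_positivity_query:
  assumes "positivity_decidable 6" and coeffs: "length as = 6" "as ! 5 \<noteq> 0"
  shows "recursive 2 (\<lambda>xs. if lrs_positive 6
    (as @ map (\<lambda>i. int (xs ! 1) * p i + int (xs ! 0) * q i) [0..<6]) then 1 else 0)"
proof -
  obtain c where c: "\<And>xs. valid_lrs_input 6 xs \<Longrightarrow>
      rec_eval c [enc_int_list xs] (if lrs_positive 6 xs then 1 else 0)"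
    using assms unfolding positivity_decidable_def by blast
  let ?inp = "\<lambda>xs. as @ map (\<lambda>i. int (xs ! 1) * p i + int (xs ! 0) * q i) [0..<6]"
  let ?fs = "map (\<lambda>e xs. int_encode e) as @
    map (\<lambda>i xs. int_encode (int (xs ! 1) * p i + int (xs ! 0) * q i)) [0..<6]"
  have "recursive 2 (\<lambda>xs. list_encode (map (\<lambda>f. f xs) ?fs))"
    by (rule recursive_list_encode)
      (auto intro!: recursive_const recursive_int_encode_linear recursive_nth)
  moreover have "list_encode (map (\<lambda>f. f xs) ?fs) = enc_int_list (?inp xs)" for xs
    by (simp add: enc_int_list_def comp_def)
  ultimately obtain e where
    e: "\<And>xs. length xs = 2 \<Longrightarrow> rec_eval e xs (enc_int_list (?inp xs))"
    unfolding recursive_def by auto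
  have "valid_lrs_input 6 (?inp xs)" for xs
    using coeffs by (simp add: valid_lrs_input_def nth_append)
  then have "rec_eval (Comp c [e]) xs (if lrs_positive 6 (?inp xs) then 1 else 0)"
    if "length xs = 2" for xs
    using rec_eval_Comp1[OF e[OF that] c] by blast
  then show ?thesis unfolding recursive_def by blast
qed

text \<open>The recurrence sequences are \<open>D\<^sup>n (b n (1 - cos (n \<theta>)) \<plusminus> a sin (n \<theta>))\<close>, where
  \<open>D cos \<theta> = A\<close> and \<open>D sin \<theta> = B\<close>.\<close>

lemma recursive_trig_comparison:
  assumes dec: "positivity_decidable 6" and "D > 0"
    and A: "of_int A = of_int D * cos \<theta>" and B: "of_int B = of_int D * sin (\<theta> :: real)"
  obtains d where "recursive 2 (\<lambda>xs. d (xs ! 0) (xs ! 1))"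
    "\<And>a b. d a b \<noteq> 0 \<longleftrightarrow>
      (\<forall>n. \<bar>real a * sin (real n * \<theta>)\<bar> \<le> real b * real n * (1 - cos (real n * \<theta>)))"
proof -
  define X where "X n = fst (gauss_power A B n)" for n
  define Y where "Y n = snd (gauss_power A B n)" for n
  have X: "of_int (X n) = of_int D ^ n * cos (real n * \<theta>)"
    and Y: "of_int (Y n) = of_int D ^ n * sin (real n * \<theta>)" for n
    using gauss_power_cos_sin[OF A B] by (auto simp: X_def Y_def)
  have "real_of_int (A\<^sup>2 + B\<^sup>2) = (of_int D)\<^sup>2 * ((cos \<theta>)\<^sup>2 + (sin \<theta>)\<^sup>2)"
    unfolding of_int_add of_int_power A B by (simp only: power_mult_distrib distrib_left)
  then have "real_of_int (A\<^sup>2 + B\<^sup>2) = of_int (D\<^sup>2)"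
    by simp
  then have "A\<^sup>2 + B\<^sup>2 = D\<^sup>2"
    by (simp only: of_int_eq_iff)
  note rec = gauss_power_recurrence[OF this, folded X_def Y_def]
  let ?as = "double_root_coeffs A D"
  \<comment> \<open>The sign \<sigma> is 1 or -1: a bound on an absolute value is the conjunction of
    two positivity queries, which \<open>d\<close> forms as a product.\<close>
  define inp where "inp \<sigma> a b = ?as @
    map (\<lambda>i. int b * (int i * (D ^ i - X i)) + int a * (\<sigma> * Y i)) [0..<6]" for \<sigma> a b
  define d where "d a b = (if lrs_positive 6 (inp 1 a b) then 1 else 0) *
    (if lrs_positive 6 (inp (- 1) a b) then 1 else (0::nat))" for a b
  \<comment> \<open>The last coefficient is \<open>- (D ^ 6)\<close>, so \<open>D > 0\<close> makes
    the queries valid inputs.\<close>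
  have len: "length ?as = 6" "?as ! 5 \<noteq> 0"
    using \<open>D > 0\<close> by (auto simp: double_root_coeffs_def)
  have "recursive 2 (\<lambda>xs. d (xs ! 0) (xs ! 1))"
    unfolding d_def inp_def by (intro recursive_mult recursive_positivity_query dec len)
  moreover have "d a b \<noteq> 0 \<longleftrightarrow>
      (\<forall>n. \<bar>real a * sin (real n * \<theta>)\<bar> \<le> real b * real n * (1 - cos (real n * \<theta>)))" for a b
  proof -
    have pos: "lrs_positive 6 (inp \<sigma> a b) \<longleftrightarrow>
        (\<forall>n. int b * (int n * (D ^ n - X n)) + int a * (\<sigma> * Y n) \<ge> 0)" for \<sigma>
    proof (rule lrs_positive_iff)
      let ?u = "\<lambda>n. int b * (int n * (D ^ n - X n)) + int a * (\<sigma> * Y n)"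
      have "is_lrs_of ?as (map ?u [0..<6]) ?u"
        by (rule is_lrs_of_double_root[where X = X and Y = Y and b = "int b" and a = "int a * \<sigma>"])
          (simp_all only: rec mult.assoc)
      then show "is_lrs_of (take 6 (inp \<sigma> a b)) (drop 6 (inp \<sigma> a b)) ?u"
        using len by (simp add: inp_def)
    qed
    have "int b * (int n * (D ^ n - X n)) + int a * (1 * Y n) \<ge> 0 \<and>
        int b * (int n * (D ^ n - X n)) + int a * (- 1 * Y n) \<ge> 0 \<longleftrightarrow>
        \<bar>real a * sin (real n * \<theta>)\<bar> \<le> real b * real n * (1 - cos (real n * \<theta>))" for n
    proof -
      have "int b * (int n * (D ^ n - X n)) + int a * (1 * Y n) \<ge> 0 \<and>
          int b * (int n * (D ^ n - X n)) + int a * (- 1 * Y n) \<ge> 0 \<longleftrightarrow>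
          \<bar>int a * Y n\<bar> \<le> int b * (int n * (D ^ n - X n))"
        by (auto simp: abs_le_iff)
      also have "\<dots> \<longleftrightarrow> real_of_int \<bar>int a * Y n\<bar> \<le> real_of_int (int b * (int n * (D ^ n - X n)))"
        by (simp only: of_int_le_iff)
      also have "real_of_int \<bar>int a * Y n\<bar> = of_int D ^ n * \<bar>real a * sin (real n * \<theta>)\<bar>"
        using \<open>D > 0\<close> by (simp add: Y abs_mult)
      also have "real_of_int (int b * (int n * (D ^ n - X n)))
          = of_int D ^ n * (real b * real n * (1 - cos (real n * \<theta>)))"
        by (simp add: X algebra_simps)
      also have "of_int D ^ n * \<bar>real a * sin (real n * \<theta>)\<bar>
            \<le> of_int D ^ n * (real b * real n * (1 - cos (real n * \<theta>))) \<longleftrightarrow>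
          \<bar>real a * sin (real n * \<theta>)\<bar> \<le> real b * real n * (1 - cos (real n * \<theta>))"
        using \<open>D > 0\<close> by (intro mult_le_cancel_left_pos) simp
      finally show ?thesis .
    qed
    then show ?thesis by (auto simp: d_def pos)
  qed
  ultimately show ?thesis using that by blast
qed

section \<open>The trigonometric comparison and the type\<close>

text \<open>This is \<open>\<bar>v\<bar> \<le> \<bar>tan v\<bar>\<close> cleared of its denominator,
  so that it covers the endpoints, where the cosine vanishes.\<close>

lemma abs_mult_cos_le_abs_sin:
  fixes v :: real
  assumes "\<bar>v\<bar> \<le> pi / 2"
  shows "\<bar>v\<bar> * \<bar>cos v\<bar> \<le> \<bar>sin v\<bar>"
proof (cases "cos v = 0")
  case False
  have "\<bar>v\<bar> \<noteq> pi / 2"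
  proof
    assume "\<bar>v\<bar> = pi / 2"
    then have "cos \<bar>v\<bar> = 0" by (simp only: cos_pi_half)
    then show False using False by simp
  qed
  then have "\<bar>v\<bar> \<le> \<bar>tan v\<bar>" using assms by (intro abs_tan_ge) auto
  then show ?thesis using False by (simp add: tan_def field_simps)
qed simp

lemma cos_sin_minus_of_int:
  "cos (2 * pi * (x - of_int k)) = cos (2 * pi * x)"
  "sin (2 * pi * (x - of_int k)) = sin (2 * pi * x)"
  by (simp_all add: right_diff_distrib cos_diff sin_diff)

text \<open>With \<open>y\<close> the signed distance from \<open>n t\<close> to a nearest integer, the inequality reads
  \<open>a \<bar>cos (\<pi> y)\<bar> \<le> b n \<bar>sin (\<pi> y)\<bar>\<close> after cancelling \<open>2 \<bar>sin (\<pi> y)\<bar>\<close>.\<close>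

lemma trig_comparison_if_le_dioph_type:
  assumes "real a \<le> real b * pi * dioph_type t"
  shows "\<bar>real a * sin (2 * pi * (real n * t))\<bar> \<le> real b * real n * (1 - cos (2 * pi * (real n * t)))"
proof (cases "n = 0")
  case False
  define y where "y = real n * t - of_int (round (real n * t))"
  define s where "s = \<bar>sin (pi * y)\<bar>"
  define c where "c = \<bar>cos (pi * y)\<bar>"
  have "\<bar>y\<bar> \<le> 1 / 2"
    using of_int_round_abs_le[of "real n * t"] by (simp add: y_def abs_minus_commute)
  then have "\<bar>pi * y\<bar> \<le> pi / 2" by (simp add: abs_mult)
  from abs_mult_cos_le_abs_sin[OF this] have tan: "pi * \<bar>y\<bar> * c \<le> s"
    by (simp add: s_def c_def abs_mult)
  have "s \<ge> 0" "c \<ge> 0" by (auto simp: s_def c_def)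
  have "real a * c \<le> real b * pi * dioph_type t * c"
    using assms \<open>c \<ge> 0\<close> by (intro mult_right_mono)
  also have "\<dots> \<le> real b * pi * (real n * \<bar>y\<bar>) * c"
    using dioph_type_le[of n t "round (real n * t)"] False \<open>c \<ge> 0\<close>
    by (intro mult_right_mono mult_left_mono) (auto simp: y_def)
  also have "\<dots> = real b * real n * (pi * \<bar>y\<bar> * c)" by simp
  also have "\<dots> \<le> real b * real n * s"
    using tan by (intro mult_left_mono) auto
  \<comment> \<open>The factor \<open>2 * s\<close> restores the double angles:
    \<open>sin (2 v) = 2 sin v cos v\<close> and \<open>1 - cos (2 v) = 2 (sin v)^2\<close>.\<close>
  finally have "2 * s * (real a * c) \<le> 2 * s * (real b * real n * s)"
    using \<open>s \<ge> 0\<close> by (intro mult_left_mono) auto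
  moreover have "\<bar>real a * sin (2 * pi * y)\<bar> = 2 * s * (real a * c)"
    using sin_double[of "pi * y"] by (simp add: s_def c_def abs_mult ac_simps)
  moreover have "real b * real n * (1 - cos (2 * pi * y)) = 2 * s * (real b * real n * s)"
    using cos_double_sin[of "pi * y"] by (simp add: s_def power2_eq_square ac_simps)
  ultimately have "\<bar>real a * sin (2 * pi * y)\<bar> \<le> real b * real n * (1 - cos (2 * pi * y))"
    by (simp only:)
  then show ?thesis
    unfolding y_def cos_sin_minus_of_int .
qed simp

text \<open>If the bound failed, some \<open>c\<close> below \<open>a / (b pi)\<close> would exceed
  \<open>m * \<bar>y\<bar>\<close> for arbitrarily large \<open>m\<close>, with \<open>y\<close> so
  small that \<open>b pi c < a \<bar>cos (pi y)\<bar>\<close>. The comparison at \<open>m\<close>,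
  after cancelling the sine and using \<open>\<bar>sin (pi y)\<bar> \<le> pi \<bar>y\<bar>\<close>,
  gives the opposite inequality.\<close>

lemma le_dioph_type_if_trig_comparison:
  assumes not_attained:
      "\<And>(n::int) (m::nat). m > 0 \<Longrightarrow> dioph_type t \<noteq> real m * \<bar>real m * t - of_int n\<bar>"
    and "b > 0"
    and cmp: "\<And>n. \<bar>real a * sin (2 * pi * (real n * t))\<bar>
      \<le> real b * real n * (1 - cos (2 * pi * (real n * t)))"
  shows "real a \<le> real b * pi * dioph_type t"
proof (rule ccontr)
  assume "\<not> real a \<le> real b * pi * dioph_type t"
  then have "dioph_type t < real a / (real b * pi)"
    using \<open>b > 0\<close> by (simp add: field_simps)
  then obtain c where c: "dioph_type t < c" "c < real a / (real b * pi)"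
    using dense by blast
  have a: "real b * pi * c < real a" using c \<open>b > 0\<close> by (simp add: field_simps)
  have "((\<lambda>y. real a * \<bar>cos (pi * y)\<bar>) \<longlongrightarrow> real a * \<bar>cos (pi * 0)\<bar>) (nhds 0)"
    by (intro tendsto_intros filterlim_ident)
  then have "\<forall>\<^sub>F y in nhds 0. real b * pi * c < real a * \<bar>cos (pi * y)\<bar>"
    using a by (intro order_tendstoD) auto
  then obtain \<eta> where "\<eta> > 0"
    and \<eta>: "\<And>y. \<bar>y\<bar> < \<eta> \<Longrightarrow> real b * pi * c < real a * \<bar>cos (pi * y)\<bar>"
    unfolding eventually_nhds_metric by auto
  \<comment> \<open>Every \<open>m > N\<close> with \<open>m * \<bar>y\<bar> < c\<close> then has
    \<open>\<bar>y\<bar> < \<eta>\<close>.\<close>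
  obtain N :: nat where N: "c / \<eta> < real N" using reals_Archimedean2 by blast
  obtain n :: int and m :: nat where "m > N" and nm: "real m * \<bar>real m * t - of_int n\<bar> < c"
    using dioph_type_large_denominator[OF not_attained c(1)] by blast
  define y where "y = real m * t - of_int n"
  have "m > 0" using \<open>m > N\<close> by simp
  have my: "real m * \<bar>y\<bar> < c" using nm by (simp add: y_def)
  have "c < \<eta> * real m"
    using N \<open>m > N\<close> \<open>\<eta> > 0\<close> by (simp add: field_simps)
      (meson less_trans mult_strict_left_mono of_nat_less_iff)
  then have "real m * \<bar>y\<bar> < real m * \<eta>" using my by (simp add: mult.commute)
  then have "\<bar>y\<bar> < \<eta>" by (simp add: \<open>m > 0\<close>)
  define s where "s = \<bar>sin (pi * y)\<bar>"
  have "\<bar>real a * sin (2 * pi * y)\<bar> \<le> real b * real m * (1 - cos (2 * pi * y))"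
    unfolding y_def cos_sin_minus_of_int by (rule cmp)
  moreover have "\<bar>real a * sin (2 * pi * y)\<bar> = 2 * s * (real a * \<bar>cos (pi * y)\<bar>)"
    using sin_double[of "pi * y"] by (simp add: s_def abs_mult ac_simps)
  moreover have "real b * real m * (1 - cos (2 * pi * y)) = 2 * s * (real b * real m * s)"
    using cos_double_sin[of "pi * y"] by (simp add: s_def power2_eq_square ac_simps)
  ultimately have "s * (real a * \<bar>cos (pi * y)\<bar>) \<le> s * (real b * real m * s)" by simp
  moreover have "s \<le> pi * \<bar>y\<bar>"
    using abs_sin_x_le_abs_x[of "pi * y"] by (simp add: s_def abs_mult)
  \<comment> \<open>If the sine vanished, \<open>m * t\<close> would be an integer and the type
    would be 0 and attained.\<close>
  moreover have "s > 0"
  proof -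
    have False if "sin (pi * y) = 0"
    proof -
      from that obtain k :: int where "pi * y = of_int k * pi" unfolding sin_zero_iff_int2 by blast
      then have "y = of_int k" by simp
      then have "real m * t - of_int (n + k) = 0" by (simp add: y_def)
      then show False
        using not_attained[OF \<open>m > 0\<close>, of "n + k"] dioph_type_le[OF \<open>m > 0\<close>, of t "n + k"]
          dioph_type_nonneg[of t] by simp
    qed
    then show ?thesis by (auto simp: s_def)
  qed
  ultimately have "real a * \<bar>cos (pi * y)\<bar> \<le> real b * real m * s" by simp
  also have "\<dots> \<le> real b * real m * (pi * \<bar>y\<bar>)"
    using \<open>s \<le> pi * \<bar>y\<bar>\<close> by (intro mult_left_mono) auto
  also have "\<dots> = real b * pi * (real m * \<bar>y\<bar>)" by simp
  also have "\<dots> \<le> real b * pi * c"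
    using my by (intro mult_left_mono) auto
  also have "\<dots> < real a * \<bar>cos (pi * y)\<bar>" by (rule \<eta>[OF \<open>\<bar>y\<bar> < \<eta>\<close>])
  finally show False by simp
qed

section \<open>From a decidable lower cut to approximations\<close>

text \<open>The least \<open>z\<close> with \<open>z + 1 > (N + 1) * x\<close> is the integer part
  of \<open>(N + 1) * x\<close>, and unbounded search finds it. The denominator \<open>Suc N\<close>
  stays in the range \<open>b > 0\<close> of the cut.\<close>

lemma approximable_if_decidable_cut:
  assumes d: "recursive 2 (\<lambda>xs. d (xs ! 0) (xs ! 1))" and "x \<ge> 0"
    and cut: "\<And>a b. b > 0 \<Longrightarrow> d a b \<noteq> 0 \<longleftrightarrow> real a \<le> real b * x"
  shows "approximable x"
proof -
  define p where "p N = (LEAST z. d (Suc z) (Suc N) = 0)" for N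
  have ex: "\<exists>z. d (Suc z) (Suc N) = 0" for N
  proof -
    obtain z :: nat where "real (Suc N) * x < real z" using reals_Archimedean2 by blast
    then have "\<not> real (Suc z) \<le> real (Suc N) * x" by simp
    then show ?thesis using cut[of "Suc N" "Suc z"] by auto
  qed
  have "recursive (Suc 1) (\<lambda>xs. d (Suc (xs ! 0)) (Suc (xs ! 1)))"
    by (intro recursive_comp2[OF d] recursive_intros) auto
  from recursive_Least[OF this] have p: "recursive 1 (\<lambda>xs. p (xs ! 0))"
    unfolding p_def using ex by simp
  have q: "recursive 1 (\<lambda>xs. Suc (xs ! 0))"
    by (intro recursive_intros) simp
  have bound: "\<bar>real (p N) / real (Suc N) - x\<bar> \<le> 1 / real (Suc N)" for N
  proof -
    have "d (Suc (p N)) (Suc N) = 0"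
      unfolding p_def using ex by (rule LeastI_ex)
    then have "real (Suc N) * x < real (p N) + 1"
      using cut[of "Suc N" "Suc (p N)"] by auto
    moreover have "real (p N) \<le> real (Suc N) * x"
    \<comment> \<open>Minimality is informative only for \<open>p N > 0\<close>; otherwise the bound
      is \<open>x \<ge> 0\<close>.\<close>
    proof (cases "p N")
      case (Suc z)
      then have "z < p N" by simp
      then have "d (Suc z) (Suc N) \<noteq> 0" unfolding p_def by (rule not_less_Least)
      then show ?thesis using cut[of "Suc N" "Suc z"] Suc by simp
    qed (use \<open>x \<ge> 0\<close> in simp)
    ultimately have "\<bar>real (p N) - real (Suc N) * x\<bar> \<le> 1" by linarith
    moreover have "real (p N) / real (Suc N) - x = (real (p N) - real (Suc N) * x) / real (Suc N)"
      by (simp add: field_simps)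
    ultimately show ?thesis
      by (simp only: abs_divide abs_of_nat divide_right_mono of_nat_0_le_iff)
  qed
  have "\<forall>\<^sub>F N in sequentially. Suc N > 0 \<and> \<bar>real (p N) / real (Suc N) - x\<bar> \<le> 1 / real N"
    using eventually_gt_at_top[of 0]
  proof eventually_elim
    case (elim N)
    then have "1 / real (Suc N) \<le> 1 / real N" by (simp add: frac_le)
    then show ?case using bound[of N] by linarith
  qed
  with p q show ?thesis by (rule approximableI)
qed

section \<open>Rational points of the unit circle and the conclusion\<close>

lemma rational_cos_sin_multiple:
  assumes "cos \<theta> \<in> \<rat>" "sin (\<theta> :: real) \<in> \<rat>"
  shows "cos (real n * \<theta>) \<in> \<rat> \<and> sin (real n * \<theta>) \<in> \<rat>"
proof (induction n)
  case (Suc n)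
  have "real (Suc n) * \<theta> = real n * \<theta> + \<theta>" by (simp add: algebra_simps)
  then show ?case
    using Suc assms by (simp only: cos_add sin_add) (auto intro!: Rats_add Rats_diff Rats_mult)
qed simp

lemma common_denominator:
  fixes p q :: rat
  obtains A B D :: int where "D > 0" "of_int A = of_int D * p" "of_int B = of_int D * q"
proof -
  obtain a d where p: "quotient_of p = (a, d)" by fastforce
  obtain b e where q: "quotient_of q = (b, e)" by fastforce
  have de: "d > 0" "e > 0" using quotient_of_denom_pos p q by blast+
  show ?thesis
    by (rule that[of "d * e" "a * e" "b * d"])
      (use de in \<open>simp_all add: quotient_of_div[OF p] quotient_of_div[OF q]\<close>)
qed

theorem theorem5p2:
  assumes "positivity_decidable 6"
  shows "\<forall>t \<in> setT. computable_real (dioph_type t)"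
proof
  fix t assume "t \<in> setT"
  then obtain p q :: rat where pq: "p\<^sup>2 + q\<^sup>2 = 1"
    and t: "t = Arg (Complex (of_rat p) (of_rat q)) / (2 * pi)"
    unfolding setT_def setA_def by blast
  define \<alpha> where "\<alpha> = Complex (of_rat p) (of_rat q)"
  define \<theta> where "\<theta> = Arg \<alpha>"
  have "(real_of_rat p)\<^sup>2 + (real_of_rat q)\<^sup>2 = 1"
    using pq by (metis of_rat_1 of_rat_add of_rat_power)
  then have "cmod \<alpha> = 1" by (simp add: \<alpha>_def cmod_def)
  then have "cis \<theta> = \<alpha>"
    using rcis_cmod_Arg[of \<alpha>] by (simp add: \<theta>_def rcis_def)
  then have \<theta>: "cos \<theta> = of_rat p" "sin \<theta> = of_rat q"
    by (auto simp: \<alpha>_def complex_eq_iff)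
  have t\<theta>: "2 * pi * (r * t) = r * \<theta>" for r
    by (simp add: t \<theta>_def \<alpha>_def)
  have "approximable (dioph_type t)"
  proof (cases "\<exists>(n::int) (m::nat). m > 0 \<and> dioph_type t = real m * \<bar>real m * t - of_int n\<bar>")
    case True
    then obtain n :: int and m :: nat where L: "dioph_type t = real m * \<bar>real m * t - of_int n\<bar>"
      by blast
    define y where "y = real m * t - of_int n"
    have "cos (2 * pi * y) \<in> \<rat> \<and> sin (2 * pi * y) \<in> \<rat>"
      unfolding y_def cos_sin_minus_of_int t\<theta>
      by (rule rational_cos_sin_multiple) (auto simp: \<theta>)
    \<comment> \<open>Passing to \<open>\<bar>y\<bar>\<close> changes at most the sign of the
      sine.\<close>
    then have "cos (2 * pi * \<bar>y\<bar>) \<in> \<rat>" "sin (2 * pi * \<bar>y\<bar>) \<in> \<rat>"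
      by (auto simp: abs_if)
    then have "approximable \<bar>y\<bar>"
      by (intro approximable_if_rational_cos_sin) auto
    from approximable_affine[OF this, of 1 0 m] show ?thesis
      by (simp add: L y_def)
  next
    case False
    obtain A B D :: int where D: "D > 0" and "of_int A = of_int D * p" "of_int B = of_int D * q"
      using common_denominator by blast
    then have "of_int A = of_int D * cos \<theta>" "of_int B = of_int D * sin \<theta>"
      unfolding \<theta> by (metis of_rat_mult of_rat_of_int_eq)+
    from recursive_trig_comparison[OF assms D this] obtain d
      where d: "recursive 2 (\<lambda>xs. d (xs ! 0) (xs ! 1))"
        and d_iff: "\<And>a b. d a b \<noteq> 0 \<longleftrightarrow>
          (\<forall>n. \<bar>real a * sin (real n * \<theta>)\<bar> \<le> real b * real n * (1 - cos (real n * \<theta>)))"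
      by blast
    have "d a b \<noteq> 0 \<longleftrightarrow> real a \<le> real b * (pi * dioph_type t)" if "b > 0" for a b
      unfolding d_iff mult.assoc[symmetric]
    proof
      assume "real a \<le> real b * pi * dioph_type t"
      from trig_comparison_if_le_dioph_type[OF this]
      show "\<forall>n. \<bar>real a * sin (real n * \<theta>)\<bar> \<le> real b * real n * (1 - cos (real n * \<theta>))"
        unfolding t\<theta> by blast
    next
      assume cmp: "\<forall>n. \<bar>real a * sin (real n * \<theta>)\<bar> \<le> real b * real n * (1 - cos (real n * \<theta>))"
      show "real a \<le> real b * pi * dioph_type t"
      proof (rule le_dioph_type_if_trig_comparison)
        show "dioph_type t \<noteq> real m * \<bar>real m * t - of_int n\<bar>" if "m > 0" for n m
          using False that by blast
      qed (use \<open>b > 0\<close> cmp in \<open>auto simp only: t\<theta>\<close>)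
    qed
    then have "approximable (pi * dioph_type t)"
      using dioph_type_nonneg by (intro approximable_if_decidable_cut[OF d]) auto
    moreover have "approximable (arctan (real 1 / real 1))"
      by (rule approximable_arctan) auto
    \<comment> \<open>Dividing by \<open>arctan 1 = pi / 4\<close> and then by 4 removes the factor
      pi.\<close>
    ultimately have "approximable (pi * dioph_type t / arctan 1)"
      by (intro approximable_divide) (auto simp: arctan_one)
    from approximable_affine[OF this, of 4 0 1] show ?thesis
      by (simp add: arctan_one)
  qed
  then show "computable_real (dioph_type t)"
    by (rule approximable_imp_computable_real)
qed

end
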